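(* Let $n\in\mathbb N_0$, let $\lambda\in\mathbb C$ with $\lambda+n+1\notin\{0,-1,-2,\ldots\}$, and let $x\in(-1,1)$, $x\ne0$. Then $$P_n^{(\lambda,\frac12)}(2x^2-1)=\frac{2^{\lambda}\,\Gamma(\lambda+n+1)}{n!\,x\,(1-x^2)^{\frac{\lambda}{2}}}\,{\sf P}_{2n+\lambda+1}^{-\lambda}(x).$$
   Context: $\mathbb N_0=\{0,1,2,\ldots\}$. The Pochhammer symbol is $(a)_0=1$, $(a)_k=a(a+1)\cdots(a+k-1)$. The Jacobi polynomial is $P_n^{(\alpha,\beta)}(y)=\frac{(\alpha+1)_n}{n!}\,{}_2F_1\left(-n,n+\alpha+\beta+1;\alpha+1;\frac{1-y}{2}\right)$, a polynomial in $y$, $\alpha$ and $\beta$ (extended by continuity in $\alpha$ where $\alpha+1\in\{0,-1,-2,\ldots\}$). The Ferrers function of the first kind is, for $\nu,\mu\in\mathbb C$ and $x\in(-1,1)$, $${\sf P}_\nu^{-\mu}(x)=\frac{1}{\Gamma(\mu+1)}\left(\frac{1-x}{1+x}\right)^{\frac{\mu}{2}}{}_2F_1\left(-\nu,\nu+1;\mu+1;\frac{1-x}{2}\right)=\left(\frac{1-x}{1+x}\right)^{\frac{\mu}{2}}\sum_{k=0}^\infty\frac{(-\nu)_k(\nu+1)_k}{\Gamma(\mu+1+k)\,k!}\left(\frac{1-x}{2}\right)^k,$$ where $1/\Gamma$ is the entire reciprocal gamma function. Here ${}_2F_1(a,b;c;z)=\sum_{k\ge0}\frac{(a)_k(b)_k}{(c)_k}\frac{z^k}{k!}$.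 Powers of positive reals are principal. *)

theory Defs
  imports "HOL-Analysis.Analysis"
begin

definition hyp2F1 :: "complex \<Rightarrow> complex \<Rightarrow> complex \<Rightarrow> complex \<Rightarrow> complex" where
  "hyp2F1 a b c z =
     (\<Sum>k. pochhammer a k * pochhammer b k / pochhammer c k * (z ^ k / fact k))"

definition jacobi_P_generic :: "nat \<Rightarrow> complex \<Rightarrow> complex \<Rightarrow> complex \<Rightarrow> complex" where
  "jacobi_P_generic n \<alpha> \<beta> y =
     pochhammer (\<alpha> + 1) n / fact n *
     hyp2F1 (- of_nat n) (of_nat n + \<alpha> + \<beta> + 1) (\<alpha> + 1) ((1 - y) / 2)"

text \<open>Where \<open>\<alpha> + 1\<close> is a nonpositive integer, the hypergeometric formula has zero
  denominators and the Jacobi polynomial is its extension by continuity in \<open>\<alpha>\<close>;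
  the limit exists by \<open>jacobi_P_generic_tendsto\<close> below.\<close>

definition jacobi_P :: "nat \<Rightarrow> complex \<Rightarrow> complex \<Rightarrow> complex \<Rightarrow> complex" where
  "jacobi_P n \<alpha> \<beta> y =
     (if \<alpha> + 1 \<in> \<int>\<^sub>\<le>\<^sub>0 then Lim (at \<alpha>) (\<lambda>a. jacobi_P_generic n a \<beta> y)
      else jacobi_P_generic n \<alpha> \<beta> y)"

text \<open>The second argument is the upper index (the order) itself, so that
  \<open>ferrers_P \<nu> (- \<mu>) x\<close> is the function usually written with upper index \<open>- \<mu>\<close> and
  involving \<open>\<Gamma>(\<mu> + 1 + k)\<close>.\<close>

definition ferrers_P :: "complex \<Rightarrow> complex \<Rightarrow> real \<Rightarrow> complex" where
  "ferrers_P \<nu> m x =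
     of_real ((1 - x) / (1 + x)) powr (- m / 2) *
     (\<Sum>k. pochhammer (- \<nu>) k * pochhammer (\<nu> + 1) k * rGamma (- m + 1 + of_nat k) / fact k *
          of_real ((1 - x) / 2) ^ k)"

lemma jacobi_P_generic_eq_sum:
  assumes "\<alpha> + 1 \<notin> \<int>\<^sub>\<le>\<^sub>0"
  shows "jacobi_P_generic n \<alpha> \<beta> y =
    (\<Sum>k\<le>n. pochhammer (- of_nat n) k * pochhammer (of_nat n + \<alpha> + \<beta> + 1) k *
       pochhammer (\<alpha> + 1 + of_nat k) (n - k) / (fact n * fact k) * ((1 - y) / 2) ^ k)"
proof -
  have nz: "pochhammer (\<alpha> + 1) k \<noteq> 0" for k
    using assms by (auto simp: pochhammer_eq_0_iff)
  have "hyp2F1 (- of_nat n) (of_nat n + \<alpha> + \<beta> + 1) (\<alpha> + 1) ((1 - y) / 2) =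
    (\<Sum>k\<le>n. pochhammer (- of_nat n) k * pochhammer (of_nat n + \<alpha> + \<beta> + 1) k /
       pochhammer (\<alpha> + 1) k * (((1 - y) / 2) ^ k / fact k))"
    unfolding hyp2F1_def
    by (rule suminf_finite) (auto simp: pochhammer_of_nat_eq_0_iff)
  then have "jacobi_P_generic n \<alpha> \<beta> y = (\<Sum>k\<le>n. pochhammer (\<alpha> + 1) n / fact n *
      (pochhammer (- of_nat n) k * pochhammer (of_nat n + \<alpha> + \<beta> + 1) k /
       pochhammer (\<alpha> + 1) k * (((1 - y) / 2) ^ k / fact k)))"
    by (simp add: jacobi_P_generic_def sum_distrib_left)
  also have "\<dots> = (\<Sum>k\<le>n. pochhammer (- of_nat n) k * pochhammer (of_nat n + \<alpha> + \<beta> + 1) k *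
       pochhammer (\<alpha> + 1 + of_nat k) (n - k) / (fact n * fact k) * ((1 - y) / 2) ^ k)"
  proof (rule sum.cong [OF refl])
    fix k assume "k \<in> {..n}"
    then have p: "pochhammer (\<alpha> + 1) n =
        pochhammer (\<alpha> + 1) k * pochhammer (\<alpha> + 1 + of_nat k) (n - k)"
      by (intro pochhammer_product) simp
    show "pochhammer (\<alpha> + 1) n / fact n *
      (pochhammer (- of_nat n) k * pochhammer (of_nat n + \<alpha> + \<beta> + 1) k /
       pochhammer (\<alpha> + 1) k * (((1 - y) / 2) ^ k / fact k)) =
       pochhammer (- of_nat n) k * pochhammer (of_nat n + \<alpha> + \<beta> + 1) k *
       pochhammer (\<alpha> + 1 + of_nat k) (n - k) / (fact n * fact k) * ((1 - y) / 2) ^ k"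
      unfolding p using nz [of k] by simp
  qed
  finally show ?thesis .
qed

lemma jacobi_P_generic_tendsto:
  "((\<lambda>a. jacobi_P_generic n a \<beta> y) \<longlongrightarrow>
    (\<Sum>k\<le>n. pochhammer (- of_nat n) k * pochhammer (of_nat n + \<alpha> + \<beta> + 1) k *
       pochhammer (\<alpha> + 1 + of_nat k) (n - k) / (fact n * fact k) * ((1 - y) / 2) ^ k)) (at \<alpha>)"
  (is "(_ \<longlongrightarrow> ?g \<alpha>) _")
proof -
  have "isCont ?g \<alpha>"
    unfolding pochhammer_prod by (intro continuous_intros) auto
  then have g: "(?g \<longlongrightarrow> ?g \<alpha>) (at \<alpha>)"
    by (simp add: isCont_def)
  have "\<exists>d>0. \<forall>a. a \<noteq> \<alpha> \<and> dist a \<alpha> < d \<longrightarrow> a + 1 \<notin> \<int>\<^sub>\<le>\<^sub>0"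
  proof (cases "\<alpha> + 1 \<in> \<int>\<^sub>\<le>\<^sub>0")
    case True
    then obtain i where i: "\<alpha> + 1 = of_int i"
      by (auto elim: nonpos_Ints_cases)
    have "a = \<alpha>" if "dist a \<alpha> < 1" and "a + 1 \<in> \<int>\<^sub>\<le>\<^sub>0" for a
    proof -
      from that(2) obtain j where j: "a + 1 = of_int j"
        by (auto elim: nonpos_Ints_cases)
      have "a - \<alpha> = (a + 1) - (\<alpha> + 1)" by simp
      also have "\<dots> = of_int (j - i)" unfolding i j by simp
      finally have "norm (of_int (j - i) :: complex) < 1"
        using that(1) by (simp add: dist_norm)
      then have "j = i"
        unfolding norm_of_int by linarith
      then show ?thesis using i j by (metis add_right_cancel)
    qed
    then show ?thesis by (meson zero_less_one)
  next
    case False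
    have "open ((\<lambda>a::complex. a + 1) -` (- \<int>\<^sub>\<le>\<^sub>0))"
      by (intro open_vimage continuous_intros) auto
    with False obtain d where "d > 0" "ball \<alpha> d \<subseteq> (\<lambda>a. a + 1) -` (- \<int>\<^sub>\<le>\<^sub>0)"
      by (metis ComplI open_contains_ball vimageI)
    then show ?thesis by (auto simp: dist_commute subset_iff intro!: exI [of _ d])
  qed
  then have "\<forall>\<^sub>F a in at \<alpha>. a + 1 \<notin> \<int>\<^sub>\<le>\<^sub>0"
    by (simp add: eventually_at)
  then have "\<forall>\<^sub>F a in at \<alpha>. ?g a = jacobi_P_generic n a \<beta> y"
    by eventually_elim (simp add: jacobi_P_generic_eq_sum)
  with g show ?thesis by (rule Lim_transform_eventually)
qed

lemma jacobi_P_eq_sum: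
  "jacobi_P n \<alpha> \<beta> y =
    (\<Sum>k\<le>n. pochhammer (- of_nat n) k * pochhammer (of_nat n + \<alpha> + \<beta> + 1) k *
       pochhammer (\<alpha> + 1 + of_nat k) (n - k) / (fact n * fact k) * ((1 - y) / 2) ^ k)"
  using tendsto_Lim [OF _ jacobi_P_generic_tendsto [of n \<beta> y \<alpha>]]
  by (simp add: jacobi_P_def jacobi_P_generic_eq_sum)

end

theory Submission
  imports Defs
begin

text \<open>
  Write \<open>F(a, b; c; z)\<close> for the regularised hypergeometric series, whose coefficients contain
  \<open>1 / \<Gamma>(c + k)\<close> instead of \<open>1 / (c)\<^sub>k\<close>, and put \<open>c = \<lambda> + 1\<close>, \<open>\<nu> = 2 n + \<lambda> + 1\<close> and
  \<open>z = (1 - x) / 2\<close>, so that \<open>x = 1 - 2 z\<close> and \<open>1 - x\<^sup>2 = 4 z (1 - z)\<close>.  Once the powers of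
  \<open>1 \<plusminus> x\<close> are collected, the claim is the identity
  \<open>F(\<nu> + 1, - \<nu>; c; z) = (1 - z)\<^sup>\<lambda> (1 - 2 z) F(- n, n + \<lambda> + 3/2; c; 4 z (1 - z))\<close>.
  It combines a quadratic transformation with Euler's transformation.

  Both are obtained here from the hypergeometric differential equation, for formal power series
  in \<open>z\<close>.  If \<open>Q\<close> satisfies the equation with parameters \<open>a, b, c\<close> and \<open>a + b = c + 1/2\<close>,
  then \<open>(1 - 2 z) Q(4 z (1 - z))\<close> satisfies it with \<open>2 a - 1, 2 b - 1, c\<close>
  (\<open>hyp_ode_quadratic\<close>).  If \<open>a + b + 1 = 2 c\<close>, then multiplication by
  \<open>(1 - z)\<^bsup>c - 1\<^esup>\<close> changes the parameters \<open>a, b\<close> to \<open>c - a, c - b\<close>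
  (\<open>hyp_ode_one_minus_powr_mult\<close>).  Hence the right-hand side satisfies the equation of the
  left-hand side.  The equation is a two-term recurrence for the coefficients, which determines
  them from the constant term unless \<open>c\<close> is a nonpositive integer (\<open>hyp_ode_unique\<close>).  In the
  exceptional case the coefficients agree because on both sides they are continuous in \<open>\<lambda>\<close>
  (\<open>fps_nth_product\<close>).  Finally the binomial series of \<open>(1 - z)\<^sup>\<lambda>\<close> converges for
  \<open>\<bar>z\<bar> < 1\<close>, so the formal identity can be evaluated (\<open>hyp_series_eq\<close>).
\<close>

section \<open>The hypergeometric equation for formal power series\<close>

text \<open>The coefficients of the regularised hypergeometric series; they are entire functions of
  all three parameters.\<close>

definition hyp_coeff :: "complex \<Rightarrow> complex \<Rightarrow> complex \<Rightarrow> nat \<Rightarrow> complex" where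
  "hyp_coeff a b c k = pochhammer a k * pochhammer b k * rGamma (c + of_nat k) / fact k"

lemma hyp_coeff_0 [simp]: "hyp_coeff a b c 0 = rGamma c"
  by (simp add: hyp_coeff_def)

lemma hyp_coeff_Suc:
  "of_nat (Suc k) * (c + of_nat k) * hyp_coeff a b c (Suc k) =
     (a + of_nat k) * (b + of_nat k) * hyp_coeff a b c k"
proof -
  have "rGamma (c + of_nat k) = (c + of_nat k) * rGamma (c + of_nat (Suc k))"
    using rGamma_plus1 [of "c + of_nat k"] by (simp add: add_ac)
  moreover have "fact (Suc k) = of_nat (Suc k) * (fact k :: complex)"
    by (rule fact_Suc)
  moreover have "of_nat (Suc k) \<noteq> (0::complex)"
    by (rule of_nat_neq_0)
  ultimately show ?thesis
    unfolding hyp_coeff_def pochhammer_Suc by (simp add: field_simps del: of_nat_Suc fact_Suc)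
qed

text \<open>The hypergeometric differential equation
  \<open>X (1 - X) F'' + (c - (a + b + 1) X) F' - a b F = 0\<close>.\<close>

definition hyp_ode :: "complex \<Rightarrow> complex \<Rightarrow> complex \<Rightarrow> complex fps \<Rightarrow> bool" where
  "hyp_ode a b c F \<longleftrightarrow>
     fps_X * (1 - fps_X) * fps_deriv (fps_deriv F) +
     (fps_const c - fps_const (a + b + 1) * fps_X) * fps_deriv F - fps_const (a * b) * F = 0"

lemma hyp_ode_iff:
  "hyp_ode a b c F \<longleftrightarrow>
     (\<forall>k. of_nat (Suc k) * (c + of_nat k) * fps_nth F (Suc k) =
          (a + of_nat k) * (b + of_nat k) * fps_nth F k)"
proof -
  have eq: "fps_X * (1 - fps_X) * fps_deriv (fps_deriv F) +
     (fps_const c - fps_const (a + b + 1) * fps_X) * fps_deriv F - fps_const (a * b) * F =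
     fps_X * fps_deriv (fps_deriv F) - fps_X * (fps_X * fps_deriv (fps_deriv F)) +
     fps_const c * fps_deriv F - fps_const (a + b + 1) * (fps_X * fps_deriv F) -
     fps_const (a * b) * F"
    by (simp add: algebra_simps)
  have nth: "fps_nth (fps_X * (1 - fps_X) * fps_deriv (fps_deriv F) +
     (fps_const c - fps_const (a + b + 1) * fps_X) * fps_deriv F - fps_const (a * b) * F) k =
     of_nat (Suc k) * (c + of_nat k) * fps_nth F (Suc k) -
     (a + of_nat k) * (b + of_nat k) * fps_nth F k" for k
  proof (cases k)
    case 0
    show ?thesis unfolding eq 0 by (simp add: algebra_simps)
  next
    case k: (Suc m)
    show ?thesis
    proof (cases m)
      case 0
      show ?thesis unfolding eq k 0 by (simp add: algebra_simps)
    next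
      case (Suc j)
      show ?thesis unfolding eq k Suc by (simp add: algebra_simps)
    qed
  qed
  show ?thesis
    unfolding hyp_ode_def fps_eq_iff nth by simp
qed

lemma hyp_ode_unique:
  assumes ode: "hyp_ode a b c F" and c: "c \<notin> \<int>\<^sub>\<le>\<^sub>0" and F0: "fps_nth F 0 = rGamma c"
  shows "fps_nth F k = hyp_coeff a b c k"
proof (induction k)
  case 0
  show ?case by (simp add: F0)
next
  case (Suc k)
  have "of_nat (Suc k) * (c + of_nat k) \<noteq> 0"
    using c by (metis mult_eq_0_iff of_nat_neq_0 minus_of_nat_in_nonpos_Ints add_eq_0_iff2)
  moreover have "of_nat (Suc k) * (c + of_nat k) * fps_nth F (Suc k) =
      of_nat (Suc k) * (c + of_nat k) * hyp_coeff a b c (Suc k)"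
    using ode unfolding hyp_ode_iff hyp_coeff_Suc Suc [symmetric] by blast
  ultimately show ?case
    by (simp only: mult_cancel_left) simp
qed

section \<open>Multiplication by a power of \<open>1 - z\<close>\<close>

text \<open>The binomial series of \<open>(1 - z)\<^sup>l\<close>.\<close>

definition one_minus_powr :: "complex \<Rightarrow> complex fps" where
  "one_minus_powr l = Abs_fps (\<lambda>k. (l gchoose k) * (- 1) ^ k)"

lemma one_minus_powr_deriv:
  "(1 - fps_X) * fps_deriv (one_minus_powr l) = - fps_const l * one_minus_powr l"
proof (rule fps_ext)
  fix k
  have A: "fps_nth ((1 - fps_X) * fps_deriv (one_minus_powr l)) k =
      of_nat (Suc k) * ((l gchoose Suc k) * (- 1) ^ Suc k) -
      of_nat k * ((l gchoose k) * (- 1) ^ k)"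
    by (cases k) (simp_all add: one_minus_powr_def algebra_simps)
  have B: "l * (l gchoose k) = of_nat k * (l gchoose k) + of_nat (Suc k) * (l gchoose (Suc k))"
    by (rule gbinomial_mult_1)
  have C: "fps_nth (- fps_const l * one_minus_powr l) k = - (l * (l gchoose k)) * (- 1) ^ k"
    by (simp add: one_minus_powr_def flip: fps_const_neg)
  show "fps_nth ((1 - fps_X) * fps_deriv (one_minus_powr l)) k =
      fps_nth (- fps_const l * one_minus_powr l) k"
    unfolding A B C by (simp add: algebra_simps del: of_nat_Suc)
qed

lemma one_minus_powr_sums:
  assumes "norm z < 1"
  shows "(\<lambda>k. fps_nth (one_minus_powr l) k * z ^ k) sums (1 - z) powr l"
  using gen_binomial_complex [of "- z" l] assms
  by (simp add: one_minus_powr_def power_minus [of z] mult_ac)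

lemma one_minus_powr_conv_radius: "fps_conv_radius (one_minus_powr l) \<ge> 1"
  unfolding fps_conv_radius_def
proof (rule conv_radius_geI_ex)
  fix r :: real assume "0 < r" "ereal r < 1"
  then show "\<exists>z. norm z = r \<and> summable (\<lambda>n. fps_nth (one_minus_powr l) n * z ^ n)"
    using one_minus_powr_sums [of "of_real r" l]
    by (intro exI [of _ "of_real r"]) (auto simp: sums_iff)
qed

text \<open>Euler's transformation \<open>F(c - a, c - b; c; z) = (1 - z)\<^bsup>a + b - c\<^esup> F(a, b; c; z)\<close> at the
  level of the differential equation, in the case where the exponent is \<open>c - 1\<close>.\<close>

lemma hyp_ode_one_minus_powr_mult:
  assumes ode: "hyp_ode a b c G" and sum: "a + b + 1 = 2 * c"
  shows "hyp_ode (c - a) (c - b) c (one_minus_powr (c - 1) * G)"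
proof -
  define B where "B = one_minus_powr (c - 1)"
  define B1 where "B1 = fps_deriv B"
  define B2 where "B2 = fps_deriv B1"
  define G1 where "G1 = fps_deriv G"
  define G2 where "G2 = fps_deriv G1"
  define A C p where "A = fps_const a" and "C = fps_const c" and "p = fps_const b"
  have p_eq: "p = 2 * C - 1 - A"
  proof -
    have "b = 2 * c - 1 - a" using sum by (simp add: algebra_simps)
    then have "p = fps_const 2 * C - 1 - A"
      unfolding p_def A_def C_def by (simp flip: fps_const_1_eq_1)
    then show ?thesis by (simp add: numeral_fps_const)
  qed
  have e1: "(1 - fps_X) * B1 = (1 - C) * B"
    using one_minus_powr_deriv [of "c - 1"]
    by (simp add: B_def B1_def C_def algebra_simps flip: fps_const_sub)
  have e2: "(1 - fps_X) * B2 = (2 - C) * B1"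
  proof -
    have "fps_deriv ((1 - fps_X) * B1) = fps_deriv ((1 - C) * B)"
      by (simp only: e1)
    then show ?thesis
      by (simp add: B1_def B2_def C_def algebra_simps)
  qed
  have g: "fps_X * (1 - fps_X) * G2 + (C - 2 * C * fps_X) * G1 - A * p * G = 0"
    using ode unfolding hyp_ode_def sum G1_def G2_def A_def C_def p_def
    by (simp add: numeral_fps_const flip: fps_const_mult)
  \<comment> \<open>The extra factor \<open>1 - X\<close> allows the derivatives of \<open>B\<close> to be eliminated without division.\<close>
  have "(1 - fps_X) * (fps_X * (1 - fps_X) * (B2 * G + 2 * B1 * G1 + B * G2) +
      (C - 2 * fps_X) * (B1 * G + B * G1) - (C - A) * (C - p) * (B * G)) = 0"
    using e1 e2 g p_eq by algebra
  then have "fps_X * (1 - fps_X) * (B2 * G + 2 * B1 * G1 + B * G2) +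
      (C - 2 * fps_X) * (B1 * G + B * G1) - (C - A) * (C - p) * (B * G) = 0"
    by (metis mult_eq_0_iff eq_iff_diff_eq_0 fps_X_neq_one)
  moreover have "fps_deriv (B * G) = B1 * G + B * G1"
    by (simp add: B1_def G1_def)
  moreover from this have "fps_deriv (fps_deriv (B * G)) = B2 * G + 2 * B1 * G1 + B * G2"
    by (simp add: B1_def B2_def G1_def G2_def algebra_simps)
  moreover have "fps_const (c - a + (c - b) + 1) = (2 :: complex fps)"
    using sum by (simp add: algebra_simps numeral_fps_const)
  moreover have "fps_const ((c - a) * (c - b)) = (C - A) * (C - p)"
    by (simp add: C_def A_def p_def)
  ultimately show ?thesis
    unfolding hyp_ode_def B_def [symmetric]
    by (simp only: C_def)
qed

section \<open>The quadratic transformation\<close>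

text \<open>The substitution \<open>w = 4 z (1 - z)\<close> satisfies \<open>w' = 4 s\<close> and \<open>1 - w = s\<^sup>2\<close> with \<open>s = 1 - 2 z\<close>.
  The left-hand side of the equation for \<open>s Q(w)\<close> is therefore \<open>4 s\<close> times the left-hand side of the
  equation for \<open>Q\<close>, taken at \<open>w\<close>.\<close>

lemma hyp_ode_quadratic:
  assumes ode: "hyp_ode a b c Q" and sum: "2 * (a + b) = 2 * c + 1"
  shows "hyp_ode (2 * a - 1) (2 * b - 1) c
           ((1 - 2 * fps_X) * (Q oo (4 * fps_X * (1 - fps_X))))"
proof -
  define W :: "complex fps" where "W = 4 * fps_X * (1 - fps_X)"
  define S :: "complex fps" where "S = 1 - 2 * fps_X"
  define Q0 where "Q0 = Q oo W"
  define Q1 where "Q1 = fps_deriv Q oo W"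
  define Q2 where "Q2 = fps_deriv (fps_deriv Q) oo W"
  define A C p where "A = fps_const a" and "C = fps_const c" and "p = fps_const b"
  have W0: "fps_nth W 0 = 0"
    by (simp add: W_def)
  have dW: "fps_deriv W = 4 * S"
    by (simp add: W_def S_def algebra_simps)
  have dS: "fps_deriv S = - 2"
    by (simp add: S_def)
  have dQ0: "fps_deriv Q0 = Q1 * (4 * S)"
    unfolding Q0_def Q1_def by (simp add: fps_compose_deriv W0 dW)
  have dQ1: "fps_deriv Q1 = Q2 * (4 * S)"
    unfolding Q1_def Q2_def by (simp add: fps_compose_deriv W0 dW)
  have p_eq: "2 * (A + p) = 2 * C + 1"
  proof -
    have "fps_const 2 * (A + p) = fps_const (2 * (a + b))"
      by (simp add: A_def p_def)
    also have "\<dots> = fps_const 2 * C + 1"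
      unfolding sum C_def by (simp flip: fps_const_1_eq_1)
    finally show ?thesis by (simp add: numeral_fps_const)
  qed
  have "(fps_X * (1 - fps_X) * fps_deriv (fps_deriv Q) +
      (C - (A + p + 1) * fps_X) * fps_deriv Q - A * p * Q) oo W = 0 oo W"
    using ode unfolding hyp_ode_def A_def C_def p_def
    by (simp only: flip: fps_const_add fps_const_mult fps_const_1_eq_1)
  then have q: "W * (1 - W) * Q2 + (C - (A + p + 1) * W) * Q1 - A * p * Q0 = 0"
    by (simp add: fps_compose_add_distrib fps_compose_sub_distrib fps_compose_mult_distrib W0
        Q0_def Q1_def Q2_def A_def C_def p_def)
  have d1: "fps_deriv (S * Q0) = 4 * S\<^sup>2 * Q1 - 2 * Q0"
    by (simp add: dS dQ0 power2_eq_square algebra_simps)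
  have d2: "fps_deriv (fps_deriv (S * Q0)) = 16 * S ^ 3 * Q2 - 24 * S * Q1"
    unfolding d1
    by (simp add: dS dQ0 dQ1 power2_eq_square power3_eq_cube algebra_simps)
  have "fps_X * (1 - fps_X) * (16 * S ^ 3 * Q2 - 24 * S * Q1) +
      C * S * (4 * S\<^sup>2 * Q1 - 2 * Q0) - (2 * A - 1) * (2 * p - 1) * (S * Q0) = 0"
    using q p_eq W_def S_def by algebra
  moreover have "2 * a - 1 + (2 * b - 1) + 1 = 2 * c"
    using sum by (simp add: algebra_simps)
  moreover have "fps_const ((2 * a - 1) * (2 * b - 1)) = (2 * A - 1) * (2 * p - 1)"
    by (simp add: A_def p_def numeral_fps_const flip: fps_const_mult fps_const_sub)
  moreover have "fps_const c - fps_const (2 * c) * fps_X = C * S"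
    by (simp add: C_def S_def algebra_simps numeral_fps_const flip: fps_const_mult)
  ultimately show ?thesis
    unfolding hyp_ode_def W_def [symmetric] S_def [symmetric] Q0_def [symmetric] d2
    by (simp only: d1)
qed

section \<open>The terminating series and its transform\<close>

text \<open>The regularised series with upper parameters \<open>- n\<close> and \<open>b\<close>, which terminates.\<close>

definition hyp_poly :: "nat \<Rightarrow> complex \<Rightarrow> complex \<Rightarrow> complex poly" where
  "hyp_poly n b c = (\<Sum>k\<le>n. monom (hyp_coeff (- of_nat n) b c k) k)"

lemma coeff_hyp_poly: "coeff (hyp_poly n b c) k = hyp_coeff (- of_nat n) b c k"
  by (auto simp: hyp_poly_def coeff_sum hyp_coeff_def pochhammer_of_nat_eq_0_iff)

lemma hyp_ode_hyp_poly: "hyp_ode (- of_nat n) b c (fps_of_poly (hyp_poly n b c))"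
  unfolding hyp_ode_iff fps_of_poly_nth coeff_hyp_poly using hyp_coeff_Suc by blast

text \<open>The polynomial \<open>(1 - 2 z) F(- n, n + l + 3/2; l + 1; 4 z (1 - z))\<close> in \<open>z\<close>.\<close>

definition quad_poly :: "nat \<Rightarrow> complex \<Rightarrow> complex poly" where
  "quad_poly n l = [:1, - 2:] * pcompose (hyp_poly n (of_nat n + l + 3 / 2) (l + 1)) [:0, 4, - 4:]"

lemma poly_quad_poly:
  "poly (quad_poly n l) z =
     (1 - 2 * z) * poly (hyp_poly n (of_nat n + l + 3 / 2) (l + 1)) (4 * z * (1 - z))"
  by (simp add: quad_poly_def poly_pcompose algebra_simps)

lemma fps_of_quad_poly:
  "fps_of_poly (quad_poly n l) = (1 - 2 * fps_X) *
     (fps_of_poly (hyp_poly n (of_nat n + l + 3 / 2) (l + 1)) oo (4 * fps_X * (1 - fps_X)))"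
proof -
  have "fps_of_poly [:1, - 2:] = (1 - 2 * fps_X :: complex fps)"
    by (simp add: fps_of_poly_pCons numeral_fps_const)
  moreover have "fps_of_poly [:0, 4, - 4:] = (4 * fps_X * (1 - fps_X) :: complex fps)"
    by (simp add: fps_of_poly_pCons numeral_fps_const algebra_simps)
  moreover have "fps_of_poly (pcompose p [:0, 4, - 4:]) =
      fps_of_poly p oo fps_of_poly [:0, 4, - 4:]" for p :: "complex poly"
    by (rule fps_of_poly_pcompose) simp
  ultimately show ?thesis
    by (simp only: quad_poly_def fps_of_poly_mult)
qed

lemma hyp_ode_product:
  "hyp_ode (2 * of_nat n + l + 2) (- (2 * of_nat n + l + 1)) (l + 1)
     (one_minus_powr l * fps_of_poly (quad_poly n l))"
proof -
  let ?b = "of_nat n + l + 3 / 2"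
  have "hyp_ode (2 * (- of_nat n) - 1) (2 * ?b - 1) (l + 1) (fps_of_poly (quad_poly n l))"
    unfolding fps_of_quad_poly
    by (rule hyp_ode_quadratic [OF hyp_ode_hyp_poly]) simp
  from hyp_ode_one_minus_powr_mult [OF this]
  show ?thesis by (simp add: algebra_simps)
qed

text \<open>The sum over \<open>j\<close> separates the dependence on \<open>l\<close> from the powers of \<open>4 z (1 - z)\<close>, so that
  continuity in \<open>l\<close> can be read off.\<close>

lemma coeff_quad_poly:
  "coeff (quad_poly n l) k = (\<Sum>j\<le>n. hyp_coeff (- of_nat n) (of_nat n + l + 3 / 2) (l + 1) j *
     coeff ([:1, - 2:] * [:0, 4, - 4:] ^ j) k)"
proof -
  have "pcompose (monom a j) q = smult a (q ^ j)" for a :: complex and j q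
    by (induction j) (simp_all add: monom_0 monom_Suc pcompose_pCons)
  then have "quad_poly n l =
      (\<Sum>j\<le>n. smult (hyp_coeff (- of_nat n) (of_nat n + l + 3 / 2) (l + 1) j)
         ([:1, - 2:] * [:0, 4, - 4:] ^ j))"
    by (simp only: quad_poly_def hyp_poly_def pcompose_sum sum_distrib_left mult_smult_right)
  then show ?thesis
    by (simp only: coeff_sum coeff_smult)
qed

lemma isCont_hyp_coeff [continuous_intros]:
  assumes "isCont f x" "isCont g x" "isCont h x"
  shows "isCont (\<lambda>x. hyp_coeff (f x) (g x) (h x) k) x"
  unfolding hyp_coeff_def pochhammer_prod by (intro continuous_intros assms) auto

lemma isCont_product_nth:
  "isCont (\<lambda>l. fps_nth (one_minus_powr l * fps_of_poly (quad_poly n l)) k) l"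
  unfolding fps_mult_nth one_minus_powr_def fps_of_poly_nth coeff_quad_poly fps_nth_Abs_fps gbinomial_prod_rev
  by (intro continuous_intros) auto

lemma fps_nth_product:
  "fps_nth (one_minus_powr l * fps_of_poly (quad_poly n l)) k =
     hyp_coeff (2 * of_nat n + l + 2) (- (2 * of_nat n + l + 1)) (l + 1) k"
proof -
  let ?F = "\<lambda>l. fps_nth (one_minus_powr l * fps_of_poly (quad_poly n l)) k"
  let ?H = "\<lambda>l. hyp_coeff (2 * of_nat n + l + 2) (- (2 * of_nat n + l + 1)) (l + 1) k"
  have generic: "?F l = ?H l" if "l + 1 \<notin> \<int>\<^sub>\<le>\<^sub>0" for l
  proof (rule hyp_ode_unique [OF hyp_ode_product that])
    have "coeff (quad_poly n l) 0 = poly (quad_poly n l) 0"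
      by (rule poly_0_coeff_0 [symmetric])
    also have "\<dots> = rGamma (l + 1)"
      unfolding poly_quad_poly by (simp add: poly_0_coeff_0 coeff_hyp_poly)
    finally show "fps_nth (one_minus_powr l * fps_of_poly (quad_poly n l)) 0 = rGamma (l + 1)"
      by (simp add: one_minus_powr_def)
  qed
  show ?thesis
  proof (cases "l + 1 \<in> \<int>\<^sub>\<le>\<^sub>0")
    case False
    then show ?thesis by (rule generic)
  next
    case True
    \<comment> \<open>Approach \<open>l\<close>, which is real in this case, through nonreal values.\<close>
    define s where "s m = l + \<i> * of_real (inverse (real (Suc m)))" for m
    have im: "Im w = 0" if "w \<in> \<int>\<^sub>\<le>\<^sub>0" for w :: complex
      using that by (auto elim!: nonpos_Ints_cases)
    have "Im (s m + 1) \<noteq> 0" for m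
      using im [OF True] by (simp add: s_def)
    then have "s m + 1 \<notin> \<int>\<^sub>\<le>\<^sub>0" for m
      using im by blast
    then have eq: "?F (s m) = ?H (s m)" for m
      by (rule generic)
    have "s \<longlonglongrightarrow> l + \<i> * of_real 0"
      unfolding s_def by (intro tendsto_intros LIMSEQ_inverse_real_of_nat)
    then have s: "s \<longlonglongrightarrow> l" by simp
    have "(\<lambda>m. ?F (s m)) \<longlonglongrightarrow> ?F l"
      by (rule isCont_tendsto_compose [OF isCont_product_nth s])
    moreover have "(\<lambda>m. ?H (s m)) \<longlonglongrightarrow> ?H l"
      by (rule isCont_tendsto_compose [OF _ s]) (intro continuous_intros)
    ultimately show ?thesis
      unfolding eq by (rule LIMSEQ_unique)
  qed
qed

section \<open>Evaluation\<close>

lemma hyp_series_eq: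
  assumes z: "norm z < 1"
  shows "(\<Sum>k. hyp_coeff (2 * of_nat n + l + 2) (- (2 * of_nat n + l + 1)) (l + 1) k * z ^ k) =
     (1 - z) powr l * ((1 - 2 * z) *
       poly (hyp_poly n (of_nat n + l + 3 / 2) (l + 1)) (4 * z * (1 - z)))"
proof -
  let ?B = "one_minus_powr l" and ?G = "fps_of_poly (quad_poly n l)"
  have r: "ereal (norm z) < fps_conv_radius ?B"
    using z one_minus_powr_conv_radius [of l] by (metis ereal_less(3) less_le_trans)
  have "(\<Sum>k. hyp_coeff (2 * of_nat n + l + 2) (- (2 * of_nat n + l + 1)) (l + 1) k * z ^ k) =
      eval_fps (?B * ?G) z"
    by (simp add: eval_fps_def fps_nth_product)
  also have "\<dots> = eval_fps ?B z * eval_fps ?G z"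
    using r by (intro eval_fps_mult) auto
  also have "eval_fps ?B z = (1 - z) powr l"
    using one_minus_powr_sums [OF z] by (simp add: eval_fps_def sums_iff)
  finally show ?thesis
    by (simp add: poly_quad_poly)
qed

text \<open>The factor \<open>\<Gamma>(\<lambda> + n + 1)\<close> turns \<open>1 / \<Gamma>(\<lambda> + 1 + k)\<close> into the Pochhammer symbol
  \<open>(\<lambda> + 1 + k)\<^bsub>n - k\<^esub>\<close> of the Jacobi coefficients.  This does not need \<open>\<lambda> + 1\<close> itself to avoid the
  nonpositive integers.\<close>

lemma jacobi_P_eq_poly:
  assumes "lam + of_nat n + 1 \<notin> \<int>\<^sub>\<le>\<^sub>0"
  shows "jacobi_P n lam \<beta> y = Gamma (lam + of_nat n + 1) / fact n *
    poly (hyp_poly n (of_nat n + lam + \<beta> + 1) (lam + 1)) ((1 - y) / 2)"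
proof -
  let ?g = "Gamma (lam + of_nat n + 1)"
  have *: "pochhammer (lam + 1 + of_nat k) (n - k) = ?g * rGamma (lam + 1 + of_nat k)"
    if "k \<le> n" for k
  proof -
    have "lam + 1 + of_nat k + of_nat (n - k) = lam + of_nat n + 1"
      using that by (simp add: of_nat_diff)
    then have "rGamma (lam + 1 + of_nat k) =
        pochhammer (lam + 1 + of_nat k) (n - k) * rGamma (lam + of_nat n + 1)"
      using pochhammer_rGamma [of "lam + 1 + of_nat k" "n - k"] by (simp only:)
    moreover have "rGamma (lam + of_nat n + 1) * ?g = 1"
      using assms by (simp add: rGamma_inverse_Gamma Gamma_eq_zero_iff)
    ultimately show ?thesis by (simp add: mult.commute)
  qed
  show ?thesis
    unfolding jacobi_P_eq_sum hyp_poly_def poly_sum poly_monom sum_distrib_left hyp_coeff_def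
    by (rule sum.cong [OF refl]) (simp add: *)
qed

theorem corollary1p6:
  fixes n :: nat and lam :: complex and x :: real
  assumes "lam + of_nat n + 1 \<notin> \<int>\<^sub>\<le>\<^sub>0"
    and "- 1 < x" and "x < 1" and "x \<noteq> 0"
  shows "jacobi_P n lam (1 / 2) (of_real (2 * x\<^sup>2 - 1)) =
    2 powr lam * Gamma (lam + of_nat n + 1) /
      (fact n * of_real x * of_real (1 - x\<^sup>2) powr (lam / 2)) *
    ferrers_P (2 * of_nat n + lam + 1) (- lam) x"
proof -
  define z :: complex where "z = of_real ((1 - x) / 2)"
  define J where "J = poly (hyp_poly n (of_nat n + lam + 3 / 2) (lam + 1)) (of_real (1 - x\<^sup>2))"
  have z: "norm z < 1"
    unfolding z_def norm_of_real using assms by simp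
  have z1: "1 - z = of_real ((1 + x) / 2)" "1 - 2 * z = of_real x" "4 * z * (1 - z) = of_real (1 - x\<^sup>2)"
    by (simp_all add: z_def field_simps power2_eq_square)
  have ferrers: "ferrers_P (2 * of_nat n + lam + 1) (- lam) x =
      of_real ((1 - x) / (1 + x)) powr (lam / 2) * (of_real ((1 + x) / 2) powr lam * (of_real x * J))"
  proof -
    have "(\<Sum>k. pochhammer (- (2 * of_nat n + lam + 1)) k *
          pochhammer (2 * of_nat n + lam + 1 + 1) k * rGamma (- (- lam) + 1 + of_nat k) / fact k *
          z ^ k) = of_real ((1 + x) / 2) powr lam * (of_real x * J)"
      using hyp_series_eq [OF z, of n lam]
      unfolding z1(3) unfolding z1(1,2) J_def hyp_coeff_def by (simp add: add.assoc mult.commute)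
    then show ?thesis
      unfolding ferrers_P_def z_def by simp
  qed
  have pos: "1 - x\<^sup>2 > 0"
    using assms by (simp add: abs_square_less_1 abs_less_iff)
  have powers: "2 powr lam * of_real ((1 - x) / (1 + x)) powr (lam / 2) * of_real ((1 + x) / 2) powr lam =
      (of_real (1 - x\<^sup>2) powr (lam / 2) :: complex)"
  proof -
    have "1 - x\<^sup>2 = (1 - x) * (1 + x)"
      by (simp add: power2_eq_square algebra_simps)
    then have lns: "ln (1 - x\<^sup>2) = ln (1 - x) + ln (1 + x)"
        "ln ((1 - x) / (1 + x)) = ln (1 - x) - ln (1 + x)" "ln ((1 + x) / 2) = ln (1 + x) - ln 2"
      using assms by (simp_all add: ln_mult ln_div)
    have powr: "of_real t powr a = exp (a * of_real (ln t))" if "t > 0" for t :: real and a :: complex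
      using that by (simp add: powr_def Ln_of_real)
    have two: "(2::complex) = of_real 2" by simp
    have "2 powr lam * of_real ((1 - x) / (1 + x)) powr (lam / 2) * of_real ((1 + x) / 2) powr lam =
        exp (lam * of_real (ln 2) + lam / 2 * of_real (ln ((1 - x) / (1 + x))) +
             lam * of_real (ln ((1 + x) / 2)))"
      unfolding two using assms by (subst (1 2 3) powr) (simp_all add: exp_add)
    also have "\<dots> = of_real (1 - x\<^sup>2) powr (lam / 2)"
      unfolding powr [OF pos] lns by (simp add: algebra_simps)
    finally show ?thesis .
  qed
  have nz: "of_real (1 - x\<^sup>2) powr (lam / 2) \<noteq> (0 :: complex)"
    using pos by (simp only: powr_eq_0_iff of_real_eq_0_iff)
  have "jacobi_P n lam (1 / 2) (of_real (2 * x\<^sup>2 - 1)) = Gamma (lam + of_nat n + 1) / fact n * J"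
  proof -
    have "(1 - of_real (2 * x\<^sup>2 - 1)) / 2 = (of_real (1 - x\<^sup>2) :: complex)"
      by (simp add: field_simps)
    moreover have "of_nat n + lam + 1 / 2 + 1 = of_nat n + lam + 3 / 2"
      by simp
    ultimately show ?thesis
      unfolding jacobi_P_eq_poly [OF assms(1)] J_def by (simp only:)
  qed
  also have "\<dots> = Gamma (lam + of_nat n + 1) / (fact n * of_real x * of_real (1 - x\<^sup>2) powr (lam / 2)) *
      (of_real (1 - x\<^sup>2) powr (lam / 2) * (of_real x * J))"
    using nz assms by simp
  also have "\<dots> = 2 powr lam * Gamma (lam + of_nat n + 1) /
      (fact n * of_real x * of_real (1 - x\<^sup>2) powr (lam / 2)) *
    ferrers_P (2 * of_nat n + lam + 1) (- lam) x"
    unfolding ferrers powers [symmetric] by (simp add: mult_ac)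
  finally show ?thesis .
qed

end
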